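(* Let $K_1,\dots,K_r\subset\mathbb{R}^n$ be nonempty closed convex sets with $K:=\bigcap_{l=1}^rK_l=\emptyset$, and let $x_0\in\mathbb{R}^n$. Suppose the best approximation algorithm (described in the context) started at $x_0$ with $J_i=\{1,\dots,r\}$ for all $i$ produces an infinite sequence $\{x_i\}$. Then any cluster point of $\left\{\frac{x_i}{\|x_i\|}\right\}$ lies in $R(K_l)$, the recession cone of $K_l$, for all $l=1,\dots,r$.
   Context: $P_C$ denotes the metric projection onto a nonempty closed convex set $C$. The quotients $x_i/\|x_i\|$ are considered for those $i$ with $x_i\neq0$. The recession cone of a nonempty closed convex set $C$ is $R(C)=\{v\mid c+tv\in C\text{ for all } c\in C,\ t\geq0\}$. Best approximation algorithm with $J_i=\{1,\dots,r\}$: given $x_0\in \mathbb{R}^n$, for $i=1,2,\dots$ and each $j\in\{1,\dots,r\}$ set $$x_i^{(j)}=P_{K_j}(x_{i-1}),\quad a_i^{(j)}=x_{i-1}-x_i^{(j)},\quad b_i^{(j)}=\langle a_i^{(j)},x_i^{(j)}\rangle;$$ define $$F_i:=\{x\in \mathbb{R}^n\mid \langle a_l^{(j)},x\rangle\leq b_l^{(j)}\text{ for all } l=1,\dots,i\text{ and } j=1,\dots,r\},$$ and set $x_i=P_{F_i}(x_0)$ (the projection of the original starting point $x_0$). The algorithm produces an infinite sequence precisely when every $F_i$ is nonempty. *)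

theory Defs
  imports "HOL-Analysis.Analysis"
begin

definition recession_cone :: "'a::real_vector set \<Rightarrow> 'a set" where
  "recession_cone C = {v. \<forall>c\<in>C. \<forall>t\<ge>0. c + t *\<^sub>R v \<in> C}"

text \<open>
  \<open>K\<close> is the family of sets, \<open>x\<close> the sequence of iterates with \<open>x 0\<close> the starting point.
  The auxiliary quantities below carry the iteration index \<open>i \<ge> 1\<close>; since \<open>i\<close> is a natural
  number, their values at \<open>i = 0\<close> are meaningless and never used.
\<close>

definition proj_pt :: "(nat \<Rightarrow> 'a::euclidean_space set) \<Rightarrow> (nat \<Rightarrow> 'a) \<Rightarrow> nat \<Rightarrow> nat \<Rightarrow> 'a" where
  "proj_pt K x i j = closest_point (K j) (x (i - 1))"

definition cut_normal :: "(nat \<Rightarrow> 'a::euclidean_space set) \<Rightarrow> (nat \<Rightarrow> 'a) \<Rightarrow> nat \<Rightarrow> nat \<Rightarrow> 'a" where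
  "cut_normal K x i j = x (i - 1) - proj_pt K x i j"

definition cut_offset :: "(nat \<Rightarrow> 'a::euclidean_space set) \<Rightarrow> (nat \<Rightarrow> 'a) \<Rightarrow> nat \<Rightarrow> nat \<Rightarrow> real" where
  "cut_offset K x i j = cut_normal K x i j \<bullet> proj_pt K x i j"

definition cut_polyhedron ::
    "(nat \<Rightarrow> 'a::euclidean_space set) \<Rightarrow> nat \<Rightarrow> (nat \<Rightarrow> 'a) \<Rightarrow> nat \<Rightarrow> 'a set" where
  "cut_polyhedron K r x i =
     {y. \<forall>l\<in>{1..i}. \<forall>j\<in>{1..r}. cut_normal K x l j \<bullet> y \<le> cut_offset K x l j}"

text \<open>
  The sequence \<open>x\<close> is the infinite sequence produced by the best approximation algorithm
  started at \<open>x0\<close>. The polyhedron at step \<open>i\<close> only depends on \<open>x 0, \<dots>, x (i - 1)\<close>, so the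
  conditions determine \<open>x\<close> recursively. Nonemptiness is required explicitly because
  \<open>closest_point\<close> has an unspecified value on the empty set; it says that the
  algorithm never stops.
\<close>

definition best_approx_sequence ::
    "(nat \<Rightarrow> 'a::euclidean_space set) \<Rightarrow> nat \<Rightarrow> 'a \<Rightarrow> (nat \<Rightarrow> 'a) \<Rightarrow> bool" where
  "best_approx_sequence K r x0 x \<longleftrightarrow>
     x 0 = x0 \<and>
     (\<forall>i\<ge>1. cut_polyhedron K r x i \<noteq> {} \<and> x i = closest_point (cut_polyhedron K r x i) x0)"

text \<open>
  Cluster points of the normalized sequence, taken over the indices with a nonzero term only:
  limits of its subsequences.
\<close>

definition direction_cluster_point :: "(nat \<Rightarrow> 'a::real_normed_vector) \<Rightarrow> 'a \<Rightarrow> bool" where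
  "direction_cluster_point x v \<longleftrightarrow>
     (\<exists>s. strict_mono s \<and> (\<forall>k::nat. x (s k) \<noteq> 0) \<and>
          (\<lambda>k. x (s k) /\<^sub>R norm (x (s k))) \<longlonglongrightarrow> v)"

end

theory Submission
  imports Defs
begin

text \<open>
  The algorithm enters through \<open>x m \<in> F\<^sub>m\<close>: every iterate obeys all cuts produced by
  the earlier ones. For one of the sets, \<open>C\<close> with projection \<open>P\<close>, this
  reads \<open>(x i - P (x i)) \<bullet> (x m - P (x i)) \<le> 0\<close> whenever \<open>i < m\<close>. It is used twice, each time
  by passing to the limit in \<open>i\<close> and \<open>m\<close> along a suitable subsequence.

  At the finite scale, if a subsequence converges to \<open>y\<close>, the limit of the cuts is
  \<open>(y - P y) \<bullet> (y - P y) \<le> 0\<close>, so \<open>y \<in> C\<close> (lemma \<open>cluster_point_in_set\<close>). A cluster point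
  would thus lie in all the sets at once; since they have no common point, the iterates have no
  bounded subsequence, that is, \<open>norm (x i)\<close> tends to infinity (lemma \<open>iterates_escape\<close>).

  At the infinite scale, let \<open>x (s k) / norm (x (s k))\<close> tend to \<open>v\<close>. Passing to a
  subsequence, the projections divided by the same norms tend to some \<open>q\<close>, which is a
  recession direction of \<open>C\<close>, being a limit of points of \<open>C\<close> divided by numbers tending to
  infinity (lemma \<open>scaled_limit_in_recession_cone\<close>). The cuts now give
  \<open>(v - q) \<bullet> v \<le> 0\<close>, and the obtuse angle criterion for the projections gives
  \<open>(v - q) \<bullet> q \<ge> 0\<close>. Together they say that \<open>(v - q) \<bullet> (v - q) \<le> 0\<close>, so \<open>v = q\<close>
  (lemma \<open>cluster_direction_in_recession_cone\<close>).
\<close>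

lemma closed_cut_polyhedron: "closed (cut_polyhedron K r x i)"
proof -
  have "cut_polyhedron K r x i =
      (\<Inter>l\<in>{1..i}. \<Inter>j\<in>{1..r}. {y. cut_normal K x l j \<bullet> y \<le> cut_offset K x l j})"
    by (auto simp: cut_polyhedron_def)
  then show ?thesis
    by (simp only:) (intro closed_INT ballI closed_halfspace_le)
qed

definition obeys_earlier_cuts :: "'a::euclidean_space set \<Rightarrow> (nat \<Rightarrow> 'a) \<Rightarrow> bool" where
  "obeys_earlier_cuts C x \<longleftrightarrow>
     (\<forall>i m. i < m \<longrightarrow>
        (x i - closest_point C (x i)) \<bullet> (x m - closest_point C (x i)) \<le> 0)"

lemma best_approx_sequence_obeys_earlier_cuts:
  assumes "best_approx_sequence K r x0 x" and "j \<in> {1..r}"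
  shows "obeys_earlier_cuts (K j) x"
  unfolding obeys_earlier_cuts_def
proof (intro allI impI)
  fix i m :: nat
  assume "i < m"
  then have "x m \<in> cut_polyhedron K r x m"
    using assms(1) closest_point_in_set[OF closed_cut_polyhedron, of K r x m x0]
    by (auto simp: best_approx_sequence_def)
  \<comment> \<open>The cut at \<open>x i\<close> is produced in the step that has number \<open>i + 1\<close>.\<close>
  with \<open>i < m\<close> assms(2)
  have "cut_normal K x (Suc i) j \<bullet> x m \<le> cut_offset K x (Suc i) j"
    by (auto simp: cut_polyhedron_def)
  then show "(x i - closest_point (K j) (x i)) \<bullet> (x m - closest_point (K j) (x i)) \<le> 0"
    by (simp add: cut_offset_def cut_normal_def proj_pt_def inner_diff_right)
qed

lemma cluster_point_in_set:
  assumes C: "C \<noteq> {}" "closed C" "convex C"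
    and cuts: "obeys_earlier_cuts C x"
    and s: "strict_mono s" and lim: "(\<lambda>k. x (s k)) \<longlonglongrightarrow> y"
  shows "y \<in> C"
proof -
  let ?P = "closest_point C"
  have P_lim: "(\<lambda>k. ?P (x (s k))) \<longlonglongrightarrow> ?P y"
    using continuous_at_closest_point[of C y] C lim by (auto intro: isCont_tendsto_compose)
  have "(x (s k) - ?P (x (s k))) \<bullet> (x (s (Suc k)) - ?P (x (s k))) \<le> 0" for k
    using cuts strict_monoD[OF s, of k "Suc k"] by (auto simp: obeys_earlier_cuts_def)
  moreover have "(\<lambda>k. (x (s k) - ?P (x (s k))) \<bullet> (x (s (Suc k)) - ?P (x (s k))))
      \<longlonglongrightarrow> (y - ?P y) \<bullet> (y - ?P y)"
    by (intro tendsto_inner tendsto_diff lim P_lim LIMSEQ_Suc[OF lim])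
  ultimately have "(y - ?P y) \<bullet> (y - ?P y) \<le> 0"
    by (auto intro: LIMSEQ_le_const2)
  then have "y = ?P y"
    by (meson inner_gt_zero_iff not_le right_minus_eq)
  then show ?thesis
    using closest_point_in_set[of C y] C by simp
qed

lemma filterlim_at_infinity_no_convergent_subseq:
  fixes x :: "nat \<Rightarrow> 'a::euclidean_space"
  assumes "\<And>s y. strict_mono s \<Longrightarrow> (\<lambda>k. x (s k)) \<longlonglongrightarrow> y \<Longrightarrow> False"
  shows "filterlim x at_infinity sequentially"
proof (rule ccontr)
  assume "\<not> ?thesis"
  then obtain B where "\<not> eventually (\<lambda>i. norm (x i) \<ge> B) sequentially"
    using filterlim_at_infinity[of 0 x sequentially] by auto
  then have "\<forall>m. \<exists>i\<ge>m. norm (x i) \<le> B"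
    by (auto simp: eventually_sequentially not_le intro: less_imp_le)
  then have "infinite {i. norm (x i) \<le> B}"
    by (auto simp: infinite_nat_iff_unbounded_le)
  then obtain s :: "nat \<Rightarrow> nat" where s: "strict_mono s" "\<And>k. norm (x (s k)) \<le> B"
    using infinite_enumerate by blast
  have "compact (cball (0::'a) B)" by simp
  moreover have "\<forall>k. (x \<circ> s) k \<in> cball 0 B" using s(2) by simp
  ultimately obtain y t where "strict_mono t" "((x \<circ> s) \<circ> t) \<longlonglongrightarrow> y"
    unfolding compact_def by meson
  then show False
    using assms[of "s \<circ> t" y] strict_mono_o[OF s(1), of t] by (simp add: o_def)
qed

lemma iterates_escape:
  assumes "\<And>j. j \<in> J \<Longrightarrow> K j \<noteq> {} \<and> closed (K j) \<and> convex (K j)"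
    and "(\<Inter>j\<in>J. K j) = {}"
    and "\<And>j. j \<in> J \<Longrightarrow> obeys_earlier_cuts (K j) x"
  shows "filterlim x at_infinity sequentially"
proof (rule filterlim_at_infinity_no_convergent_subseq)
  fix s y
  assume "strict_mono s" "(\<lambda>k. x (s k)) \<longlonglongrightarrow> y"
  then have "y \<in> K j" if "j \<in> J" for j
    using that assms cluster_point_in_set by blast
  then show False using assms(2) by blast
qed

text \<open>
  The point \<open>c + t q\<close> is approximated by the convex combinations of \<open>c\<close> and \<open>p k\<close> in which
  \<open>p k\<close> has the weight \<open>t / n k\<close>.
\<close>

lemma scaled_limit_in_recession_cone:
  fixes C :: "'a::real_normed_vector set"
  assumes C: "closed C" "convex C" and p: "\<And>k. p k \<in> C"
    and n: "filterlim n at_top sequentially"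
    and lim: "(\<lambda>k. p k /\<^sub>R n k) \<longlonglongrightarrow> q"
  shows "q \<in> recession_cone C"
  unfolding recession_cone_def
proof (intro CollectI ballI allI impI)
  fix c and t :: real
  assume c: "c \<in> C" and t: "t \<ge> 0"
  let ?w = "\<lambda>k. t / n k"
  have "?w \<longlonglongrightarrow> 0"
    by (rule real_tendsto_divide_at_top[OF tendsto_const n])
  then have "(\<lambda>k. (1 - ?w k) *\<^sub>R c + t *\<^sub>R (p k /\<^sub>R n k)) \<longlonglongrightarrow> (1 - 0) *\<^sub>R c + t *\<^sub>R q"
    by (intro tendsto_intros lim)
  moreover have "eventually (\<lambda>k. n k \<ge> max t 1) sequentially"
    using n unfolding filterlim_at_top by blast
  then have "eventually (\<lambda>k. (1 - ?w k) *\<^sub>R c + t *\<^sub>R (p k /\<^sub>R n k) \<in> C) sequentially"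
  proof eventually_elim
    case (elim k)
    have "(1 - ?w k) *\<^sub>R c + ?w k *\<^sub>R p k \<in> C"
      using elim t by (intro convexD_alt C c p) auto
    then show ?case by (simp add: divide_inverse)
  qed
  ultimately show "c + t *\<^sub>R q \<in> C"
    using Lim_in_closed_set[OF C(1)] by fastforce
qed

lemma cluster_direction_in_recession_cone:
  assumes C: "C \<noteq> {}" "closed C" "convex C"
    and cuts: "obeys_earlier_cuts C x"
    and escape: "filterlim x at_infinity sequentially"
    and v: "direction_cluster_point x v"
  shows "v \<in> recession_cone C"
proof -
  let ?P = "closest_point C"
  obtain s where s: "strict_mono s" "\<And>k. x (s k) \<noteq> 0"
    and s_lim: "(\<lambda>k. x (s k) /\<^sub>R norm (x (s k))) \<longlonglongrightarrow> v"
    using v unfolding direction_cluster_point_def by blast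
  have norm_x: "filterlim (\<lambda>i. norm (x i)) at_top sequentially"
    by (rule filterlim_at_infinity_imp_norm_at_top[OF escape])
  \<comment> \<open>Since the projection is nonexpansive, the scaled projections stay bounded.\<close>
  have "bounded (range (\<lambda>k. ?P (x (s k)) /\<^sub>R norm (x (s k))))"
  proof -
    have "filterlim (\<lambda>k. norm (x (s k))) at_top sequentially"
      using filterlim_compose[OF norm_x filterlim_subseq[OF s(1)]] .
    then have "(\<lambda>k. norm (?P 0) / norm (x (s k))) \<longlonglongrightarrow> 0"
      by (rule real_tendsto_divide_at_top[OF tendsto_const])
    then have "Bseq (\<lambda>k. norm (?P 0) / norm (x (s k)))"
      by (intro convergent_imp_Bseq convergentI)
    then obtain B where B: "\<And>k. norm (norm (?P 0) / norm (x (s k))) \<le> B"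
      unfolding Bseq_def by blast
    have "norm (?P (x (s k)) /\<^sub>R norm (x (s k))) \<le> 1 + B" for k
    proof -
      have "norm (?P (x (s k)) - ?P 0) \<le> norm (x (s k))"
        using closest_point_lipschitz[of C "x (s k)" 0] C by (simp add: dist_norm)
      then have "norm (?P (x (s k))) \<le> norm (x (s k)) + norm (?P 0)"
        using norm_triangle_sub[of "?P (x (s k))" "?P 0"] by linarith
      then have "norm (?P (x (s k))) / norm (x (s k)) \<le> 1 + norm (?P 0) / norm (x (s k))"
        using s(2)[of k] by (simp add: field_simps)
      then show ?thesis
        using B[of k] by (simp add: divide_inverse mult.commute)
    qed
    then show ?thesis
      by (auto simp: bounded_iff)
  qed
  then obtain q t where t: "strict_mono t"
    and t_lim: "((\<lambda>k. ?P (x (s k)) /\<^sub>R norm (x (s k))) \<circ> t) \<longlonglongrightarrow> q"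
    using bounded_imp_convergent_subsequence by blast
  define u where "u k = x (s (t k))" for k
  define n where "n k = norm (u k)" for k
  define p where "p k = ?P (u k)" for k
  have st: "strict_mono (\<lambda>k. s (t k))"
    using strict_mono_o[OF s(1) t] by (simp add: o_def)
  have n_pos: "n k > 0" for k
    using s(2) by (simp add: n_def u_def)
  have n_top: "filterlim n at_top sequentially"
    unfolding n_def u_def using filterlim_compose[OF norm_x filterlim_subseq[OF st]] .
  have u_lim: "(\<lambda>k. u k /\<^sub>R n k) \<longlonglongrightarrow> v"
    using LIMSEQ_subseq_LIMSEQ[OF s_lim t] by (simp add: n_def u_def o_def)
  have p_lim: "(\<lambda>k. p k /\<^sub>R n k) \<longlonglongrightarrow> q"
    using t_lim by (simp add: n_def u_def p_def o_def)
  have const_lim: "(\<lambda>k. c /\<^sub>R n k) \<longlonglongrightarrow> 0" for c :: 'a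
    using tendsto_scaleR[OF tendsto_inverse_0_at_top[OF n_top] tendsto_const[of c]] by simp
  have p_in: "p k \<in> C" for k
    unfolding p_def by (rule closest_point_in_set) (use C in auto)
  have q: "q \<in> recession_cone C"
    by (rule scaled_limit_in_recession_cone[OF C(2,3) p_in n_top p_lim])
  have a_lim: "(\<lambda>k. (u k - p k) /\<^sub>R n k) \<longlonglongrightarrow> v - q"
    using tendsto_diff[OF u_lim p_lim] by (simp add: scaleR_diff_right)
  \<comment> \<open>Cut at a fixed iterate: all later iterates, hence their limit direction, respect it.\<close>
  have "(u k - p k) \<bullet> v \<le> 0" for k
  proof -
    have "(\<lambda>m. (u k - p k) \<bullet> (u m /\<^sub>R n m - p k /\<^sub>R n m)) \<longlonglongrightarrow> (u k - p k) \<bullet> (v - 0)"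
      by (intro tendsto_intros u_lim const_lim)
    moreover have "(u k - p k) \<bullet> (u m /\<^sub>R n m - p k /\<^sub>R n m) \<le> 0" if "m > k" for m
    proof -
      have "(u k - p k) \<bullet> (u m - p k) \<le> 0"
        using cuts strict_monoD[OF st that]
        by (auto simp: obeys_earlier_cuts_def u_def p_def)
      then have "inverse (n m) * ((u k - p k) \<bullet> (u m - p k)) \<le> 0"
        using n_pos[of m] by (simp add: mult_le_0_iff)
      then show ?thesis
        by (metis inner_scaleR_right scaleR_diff_right)
    qed
    ultimately have "(u k - p k) \<bullet> (v - 0) \<le> 0"
      by (intro LIMSEQ_le_const2[of _ _ 0]) (auto intro: exI[of _ "Suc k"])
    then show ?thesis by simp
  qed
  then have "((u k - p k) /\<^sub>R n k) \<bullet> v \<le> 0" for k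
    using n_pos[of k] by (simp add: mult_le_0_iff)
  then have cut_limit: "(v - q) \<bullet> v \<le> 0"
    using tendsto_inner[OF a_lim tendsto_const[of v]] by (auto intro: LIMSEQ_le_const2)
  obtain c where c: "c \<in> C"
    using C(1) by blast
  \<comment> \<open>The obtuse angle criterion at a fixed point of \<open>C\<close>, which vanishes after scaling.\<close>
  have "((u k - p k) /\<^sub>R n k) \<bullet> (c /\<^sub>R n k - p k /\<^sub>R n k) \<le> 0" for k
  proof -
    have "(u k - p k) \<bullet> (c - p k) \<le> 0"
      unfolding p_def by (rule closest_point_dot[OF C(3,2) c])
    then have "(inverse (n k) * inverse (n k)) * ((u k - p k) \<bullet> (c - p k)) \<le> 0"
      by (simp add: mult_le_0_iff)
    then show ?thesis
      by (metis inner_scaleR_left inner_scaleR_right mult.assoc scaleR_diff_right)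
  qed
  then have obtuse_limit: "(v - q) \<bullet> (0 - q) \<le> 0"
    by (intro LIMSEQ_le_const2[OF tendsto_inner[OF a_lim tendsto_diff[OF const_lim p_lim]]]) blast
  from cut_limit obtuse_limit have "(v - q) \<bullet> (v - q) \<le> 0"
    by (simp add: inner_diff_right)
  then have "v = q"
    by (meson inner_gt_zero_iff not_le right_minus_eq)
  with q show ?thesis by simp
qed

theorem theorem6p2:
  fixes K :: "nat \<Rightarrow> (real ^ 'n) set" and r :: nat
    and x0 :: "real ^ 'n" and x :: "nat \<Rightarrow> real ^ 'n" and v :: "real ^ 'n"
  assumes "\<And>l. l \<in> {1..r} \<Longrightarrow> K l \<noteq> {} \<and> closed (K l) \<and> convex (K l)"
    and "(\<Inter>l\<in>{1..r}. K l) = {}"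
    and "best_approx_sequence K r x0 x"
    and "direction_cluster_point x v"
  shows "\<forall>l\<in>{1..r}. v \<in> recession_cone (K l)"
proof
  note cuts = best_approx_sequence_obeys_earlier_cuts[OF assms(3)]
  have escape: "filterlim x at_infinity sequentially"
    using assms(1,2) cuts by (rule iterates_escape)
  fix l
  assume "l \<in> {1..r}"
  then show "v \<in> recession_cone (K l)"
    using cluster_direction_in_recession_cone[OF _ _ _ cuts escape assms(4)] assms(1) by blast
qed

end
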